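(* Let $M$ be a faithful multiplication $R$-module and $S$ be a multiplicatively closed subset of $R$. For a submodule $N$ of $M$, the following are equivalent. (1) $N$ is a weakly $S$-prime submodule of $M$. (2) $N\cap SM=\emptyset$ and there exists $s\in S$ such that whenever $K,L$ are submodules of $M$ and $0\neq KL\subseteq N$, then $sK\subseteq N$ or $sL\subseteq N$.
   Context: $R$ is a commutative ring with non-zero identity and modules are unital. A non-empty subset $S$ of $R$ is multiplicatively closed if it is a subsemigroup of $R$ under multiplication. $SM=\{sm: s\in S, m\in M\}$. For a submodule $N$ of $M$, $(N:_{R}M)=\{r\in R: rM\subseteq N\}$. $M$ is faithful if its annihilator in $R$ is zero. $M$ is a multiplication module if every submodule of $M$ has the form $IM$ for some ideal $I$ of $R$; the product of two submodules $K,L$ of a multiplication module $M$ is $KL=(K:_{R}M)(L:_{R}M)M$. A submodule $N$ of $M$ with $(N:_{R}M)\cap S=\emptyset$ is weakly $S$-prime if there exists a fixed $s\in S$ such that for all $a\in R$, $m\in M$ with $0\neq am\in N$, either $sa\in(N:_{R}M)$ or $sm\in N$.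
   Formalization: In (2), the condition "N ∩ SM = ∅", which never holds since 0 lies in both N and SM, is replaced by "(N :_R M) ∩ S = ∅"; as printed the equivalence fails, e.g. for R = M = ℤ, S = {1}, N = 2ℤ. *)

theory Defs
  imports "HOL-Algebra.Module" "HOL-Algebra.Ideal_Product"
begin

definition mult_closed_subset :: "('a, 'r) ring_scheme \<Rightarrow> 'a set \<Rightarrow> bool"
  where "mult_closed_subset R S \<longleftrightarrow>
    S \<subseteq> carrier R \<and> S \<noteq> {} \<and> (\<forall>s\<in>S. \<forall>t\<in>S. s \<otimes>\<^bsub>R\<^esub> t \<in> S)"

text \<open>The set \<open>SX\<close> of products, not closed under sums; \<open>sX\<close> is \<open>smult_set M {s} X\<close>.\<close>

definition smult_set :: "('a, 'b, 'm) module_scheme \<Rightarrow> 'a set \<Rightarrow> 'b set \<Rightarrow> 'b set"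
  where "smult_set M S X = {s \<odot>\<^bsub>M\<^esub> x | s x. s \<in> S \<and> x \<in> X}"

text \<open>\<open>(N :\<^sub>R M)\<close>\<close>

definition residual :: "('a, 'r) ring_scheme \<Rightarrow> ('a, 'b, 'm) module_scheme \<Rightarrow> 'b set \<Rightarrow> 'a set"
  where "residual R M N = {r \<in> carrier R. smult_set M {r} (carrier M) \<subseteq> N}"

definition annihilator :: "('a, 'r) ring_scheme \<Rightarrow> ('a, 'b, 'm) module_scheme \<Rightarrow> 'a set"
  where "annihilator R M = {r \<in> carrier R. \<forall>m\<in>carrier M. r \<odot>\<^bsub>M\<^esub> m = \<zero>\<^bsub>M\<^esub>}"

definition faithful_module :: "('a, 'r) ring_scheme \<Rightarrow> ('a, 'b, 'm) module_scheme \<Rightarrow> bool"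
  where "faithful_module R M \<longleftrightarrow> module R M \<and> annihilator R M = {\<zero>\<^bsub>R\<^esub>}"

text \<open>
  The submodule \<open>IM\<close>: finite sums of products \<open>im\<close>, in the style of \<^const>\<open>ideal_prod\<close>.
  For a nonempty \<open>I\<close> the empty sum needs no rule of its own, since \<open>i0 = 0\<close>.
\<close>

inductive_set ideal_smult :: "('a, 'b, 'm) module_scheme \<Rightarrow> 'a set \<Rightarrow> 'b set"
  for M and I
  where
    smult: "\<lbrakk> i \<in> I; m \<in> carrier M \<rbrakk> \<Longrightarrow> i \<odot>\<^bsub>M\<^esub> m \<in> ideal_smult M I"
  | sum: "\<lbrakk> x \<in> ideal_smult M I; y \<in> ideal_smult M I \<rbrakk> \<Longrightarrow> x \<oplus>\<^bsub>M\<^esub> y \<in> ideal_smult M I"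

definition multiplication_module :: "('a, 'r) ring_scheme \<Rightarrow> ('a, 'b, 'm) module_scheme \<Rightarrow> bool"
  where "multiplication_module R M \<longleftrightarrow>
    module R M \<and> (\<forall>N. submodule N R M \<longrightarrow> (\<exists>I. ideal I R \<and> N = ideal_smult M I))"

text \<open>\<open>KL = (K :\<^sub>R M)(L :\<^sub>R M)M\<close>\<close>

definition submodule_prod ::
    "('a, 'r) ring_scheme \<Rightarrow> ('a, 'b, 'm) module_scheme \<Rightarrow> 'b set \<Rightarrow> 'b set \<Rightarrow> 'b set"
  where "submodule_prod R M K L =
    ideal_smult M (ideal_prod R (residual R M K) (residual R M L))"

definition weakly_S_prime ::
    "('a, 'r) ring_scheme \<Rightarrow> ('a, 'b, 'm) module_scheme \<Rightarrow> 'a set \<Rightarrow> 'b set \<Rightarrow> bool"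
  where "weakly_S_prime R M S N \<longleftrightarrow>
    submodule N R M \<and> residual R M N \<inter> S = {} \<and>
    (\<exists>s\<in>S. \<forall>a\<in>carrier R. \<forall>m\<in>carrier M.
      a \<odot>\<^bsub>M\<^esub> m \<noteq> \<zero>\<^bsub>M\<^esub> \<and> a \<odot>\<^bsub>M\<^esub> m \<in> N \<longrightarrow>
      s \<otimes>\<^bsub>R\<^esub> a \<in> residual R M N \<or> s \<odot>\<^bsub>M\<^esub> m \<in> N)"

text \<open>
  The elementwise condition \<open>N \<inter> SM = \<emptyset>\<close> can never hold, because \<open>0 = s0\<close> lies in both sets.
  A disjointness hypothesis between \<open>N\<close> and \<open>SM\<close> is therefore read as: no \<open>sM\<close> with
  \<open>s \<in> S\<close> is contained in \<open>N\<close>, that is, \<open>(N :\<^sub>R M) \<inter> S = \<emptyset>\<close>.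
\<close>

lemma submodule_Int_smult_set_nonempty:
  assumes "module R M" and "mult_closed_subset R S" and "submodule N R M"
  shows "N \<inter> smult_set M S (carrier M) \<noteq> {}"
proof -
  interpret module R M by fact
  obtain s where s: "s \<in> S" "s \<in> carrier R"
    using assms(2) unfolding mult_closed_subset_def by blast
  have "\<zero>\<^bsub>M\<^esub> \<in> N"
    using subgroup.one_closed[OF submodule.axioms(1)[OF assms(3)]] by simp
  moreover have "s \<odot>\<^bsub>M\<^esub> \<zero>\<^bsub>M\<^esub> = \<zero>\<^bsub>M\<^esub>"
    using s by simp
  then have "\<zero>\<^bsub>M\<^esub> \<in> smult_set M S (carrier M)"
    using s M.zero_closed unfolding smult_set_def by force
  ultimately show ?thesis by blast
qed

lemma residual_Int_eq_empty_iff: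
  assumes "mult_closed_subset R S"
  shows "residual R M N \<inter> S = {} \<longleftrightarrow> (\<forall>s\<in>S. \<not> smult_set M {s} (carrier M) \<subseteq> N)"
  using assms unfolding residual_def mult_closed_subset_def by blast

end

theory Submission
  imports Defs
begin

text \<open>
  In a multiplication module every submodule is recovered from its residual, \<open>L = (L : M)M\<close>.
  Hence \<open>KL \<subseteq> P\<close> says no more than \<open>al \<in> P\<close> for all \<open>a \<in> (K : M)\<close> and \<open>l \<in> L\<close>
  (\<open>submodule_prod_subset_iff\<close>). Used with \<open>P = N\<close> and with \<open>P = 0\<close>, this turns both
  \<open>KL \<subseteq> N\<close> and \<open>KL = 0\<close> into statements about single products \<open>al\<close>.

  If the condition on products holds, it is applied to \<open>K = aM\<close> and \<open>L = Rm\<close>. Their product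
  contains \<open>am\<close>, and it lies in \<open>N\<close> as soon as \<open>am\<close> does, because \<open>j(ay) = a(jy)\<close> is a multiple
  of \<open>am\<close> whenever \<open>jM \<subseteq> Rm\<close> (\<open>submodule_prod_cyclic\<close>).

  If \<open>N\<close> is weakly \<open>S\<close>-prime with witness \<open>s\<close>, put \<open>I = (K : M)\<close> and suppose that every
  product \<open>al\<close> with \<open>a \<in> I\<close>, \<open>l \<in> L\<close> lies in \<open>N\<close>. The difficulty is that the
  condition on \<open>N\<close> says nothing about products \<open>al = 0\<close>. For a fixed \<open>a \<in> I\<close> with
  \<open>saM \<not>\<subseteq> N\<close>, it makes \<open>L\<close> the union of the subgroups of those \<open>l\<close> with \<open>sl \<in> N\<close> and
  of those with \<open>al = 0\<close>. A group is never the union of two proper subgroups, so \<open>sL \<subseteq> N\<close> or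
  \<open>aL = 0\<close>. If \<open>sL \<not>\<subseteq> N\<close>, the ideal \<open>I\<close> is therefore the union of the subgroups
  \<open>saM \<subseteq> N\<close> and \<open>aL = 0\<close>, and the same principle gives \<open>sIM \<subseteq> N\<close>, that is
  \<open>sK \<subseteq> N\<close>, or \<open>IL = 0\<close>, that is \<open>KL = 0\<close>
  (\<open>weakly_prime_covering\<close>).
\<close>

section \<open>Groups covered by two subgroups\<close>

text \<open>
  If \<open>h \<in> H\<close> misses \<open>A\<close> and \<open>k \<in> H\<close> misses \<open>B\<close>, then \<open>h \<in> B\<close> and
  \<open>k \<in> A\<close>, so \<open>hk\<close> can lie in neither subgroup.
\<close>

lemma (in group) subgroup_subset_Un:
  assumes H: "subgroup H G" and A: "subgroup A G" and B: "subgroup B G"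
    and cover: "H \<subseteq> A \<union> B"
  shows "H \<subseteq> A \<or> H \<subseteq> B"
proof (rule ccontr)
  assume "\<not> ?thesis"
  then obtain h k where h: "h \<in> H" "h \<notin> A" and k: "k \<in> H" "k \<notin> B"
    by blast
  with cover have "h \<in> B" "k \<in> A"
    by blast+
  have G: "h \<in> carrier G" "k \<in> carrier G"
    using h k H by (auto dest: subgroup.mem_carrier)
  have "h \<otimes> k \<in> A \<union> B"
    using cover h k H by (auto intro: subgroup.m_closed)
  then show False
  proof
    assume "h \<otimes> k \<in> A"
    then have "(h \<otimes> k) \<otimes> inv k \<in> A"
      using A \<open>k \<in> A\<close> by (auto intro: subgroup.m_closed subgroup.m_inv_closed)
    with h G show False
      by (simp add: m_assoc)
  next
    assume "h \<otimes> k \<in> B"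
    then have "inv h \<otimes> (h \<otimes> k) \<in> B"
      using B \<open>h \<in> B\<close> by (auto intro: subgroup.m_closed subgroup.m_inv_closed)
    with k G show False
      by (simp add: m_assoc [symmetric])
  qed
qed

section \<open>Colon subgroups and the submodules \<open>aM\<close> and \<open>Rm\<close>\<close>

lemma mem_residual_iff:
  "r \<in> residual R M N \<longleftrightarrow> r \<in> carrier R \<and> (\<forall>m\<in>carrier M. r \<odot>\<^bsub>M\<^esub> m \<in> N)"
  unfolding residual_def smult_set_def by auto

context module
begin

lemma submodule_zero_closed: "submodule N R M \<Longrightarrow> \<zero>\<^bsub>M\<^esub> \<in> N"
  using subgroup.one_closed[OF submodule.axioms(1)] by fastforce

lemma zero_submodule: "submodule {\<zero>\<^bsub>M\<^esub>} R M"
  by (rule submoduleI) auto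

lemma smult_left_commute: "a \<in> carrier R \<Longrightarrow> b \<in> carrier R \<Longrightarrow> m \<in> carrier M \<Longrightarrow>
    a \<odot>\<^bsub>M\<^esub> (b \<odot>\<^bsub>M\<^esub> m) = b \<odot>\<^bsub>M\<^esub> (a \<odot>\<^bsub>M\<^esub> m)"
  by (metis R.m_comm smult_assoc1)

text \<open>
  The colon ideal \<open>(P :\<^sub>R X)\<close>. The sets \<open>(K :\<^sub>R M)\<close>, \<open>(N :\<^sub>R sM)\<close> and \<open>(0 :\<^sub>R L)\<close>, which
  occur together in the covering argument, are all of this form.
\<close>

lemma subgroup_ring_colon:
  assumes P: "submodule P R M" and X: "X \<subseteq> carrier M"
  shows "subgroup {r \<in> carrier R. \<forall>x\<in>X. r \<odot>\<^bsub>M\<^esub> x \<in> P} (add_monoid R)"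
proof (rule R.add.subgroupI)
  show "{r \<in> carrier R. \<forall>x\<in>X. r \<odot>\<^bsub>M\<^esub> x \<in> P} \<noteq> {}"
    using X submodule_zero_closed[OF P] by (fastforce intro: exI[of _ "\<zero>\<^bsub>R\<^esub>"])
next
  fix r assume "r \<in> {r \<in> carrier R. \<forall>x\<in>X. r \<odot>\<^bsub>M\<^esub> x \<in> P}"
  then show "\<ominus>\<^bsub>R\<^esub> r \<in> {r \<in> carrier R. \<forall>x\<in>X. r \<odot>\<^bsub>M\<^esub> x \<in> P}"
    using X submoduleE(3)[OF P] by (auto simp: smult_l_minus subset_iff)
next
  fix r t assume "r \<in> {r \<in> carrier R. \<forall>x\<in>X. r \<odot>\<^bsub>M\<^esub> x \<in> P}"
    and "t \<in> {r \<in> carrier R. \<forall>x\<in>X. r \<odot>\<^bsub>M\<^esub> x \<in> P}"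
  then show "r \<oplus>\<^bsub>R\<^esub> t \<in> {r \<in> carrier R. \<forall>x\<in>X. r \<odot>\<^bsub>M\<^esub> x \<in> P}"
    using X submoduleE(5)[OF P] by (auto simp: smult_l_distr subset_iff)
qed auto

lemma subgroup_module_colon:
  assumes P: "submodule P R M" and a: "a \<in> carrier R"
  shows "subgroup {m \<in> carrier M. a \<odot>\<^bsub>M\<^esub> m \<in> P} (add_monoid M)"
proof (rule M.add.subgroupI)
  show "{m \<in> carrier M. a \<odot>\<^bsub>M\<^esub> m \<in> P} \<noteq> {}"
    using a submodule_zero_closed[OF P] by (fastforce intro: exI[of _ "\<zero>\<^bsub>M\<^esub>"])
qed (use a submoduleE(3,5)[OF P] in \<open>auto simp: smult_r_minus smult_r_distr\<close>)

lemma submodule_smult_carrier: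
  assumes "a \<in> carrier R"
  shows "submodule (smult_set M {a} (carrier M)) R M"
proof (rule submoduleI)
  show "\<zero>\<^bsub>M\<^esub> \<in> smult_set M {a} (carrier M)"
    using assms unfolding smult_set_def by (force intro: exI[of _ "\<zero>\<^bsub>M\<^esub>"])
next
  fix x assume "x \<in> smult_set M {a} (carrier M)"
  then show "\<ominus>\<^bsub>M\<^esub> x \<in> smult_set M {a} (carrier M)"
    using assms unfolding smult_set_def by (auto simp: smult_r_minus[symmetric])
next
  fix x y assume "x \<in> smult_set M {a} (carrier M)" "y \<in> smult_set M {a} (carrier M)"
  then show "x \<oplus>\<^bsub>M\<^esub> y \<in> smult_set M {a} (carrier M)"
    using assms unfolding smult_set_def by (auto simp: smult_r_distr[symmetric])
next
  fix r x assume "r \<in> carrier R" "x \<in> smult_set M {a} (carrier M)"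
  then show "r \<odot>\<^bsub>M\<^esub> x \<in> smult_set M {a} (carrier M)"
    using assms smult_left_commute[of r a] unfolding smult_set_def by auto
qed (use assms in \<open>auto simp: smult_set_def\<close>)

lemma submodule_cyclic:
  assumes "m \<in> carrier M"
  shows "submodule (smult_set M (carrier R) {m}) R M"
proof (rule submoduleI)
  show "\<zero>\<^bsub>M\<^esub> \<in> smult_set M (carrier R) {m}"
    using assms unfolding smult_set_def by (force intro: exI[of _ "\<zero>\<^bsub>R\<^esub>"])
next
  fix x assume "x \<in> smult_set M (carrier R) {m}"
  then show "\<ominus>\<^bsub>M\<^esub> x \<in> smult_set M (carrier R) {m}"
    using assms unfolding smult_set_def by (auto simp: smult_l_minus[symmetric])
next
  fix x y assume "x \<in> smult_set M (carrier R) {m}" "y \<in> smult_set M (carrier R) {m}"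
  then show "x \<oplus>\<^bsub>M\<^esub> y \<in> smult_set M (carrier R) {m}"
    using assms unfolding smult_set_def by (auto simp: smult_l_distr[symmetric])
next
  fix r x assume "r \<in> carrier R" "x \<in> smult_set M (carrier R) {m}"
  then show "r \<odot>\<^bsub>M\<^esub> x \<in> smult_set M (carrier R) {m}"
    using assms unfolding smult_set_def by (auto simp: smult_assoc1[symmetric])
qed (use assms in \<open>auto simp: smult_set_def\<close>)

section \<open>Products of submodules\<close>

lemma ideal_smult_subset_iff:
  assumes P: "submodule P R M"
  shows "ideal_smult M I \<subseteq> P \<longleftrightarrow> (\<forall>i\<in>I. \<forall>x\<in>carrier M. i \<odot>\<^bsub>M\<^esub> x \<in> P)"
proof
  assume *: "\<forall>i\<in>I. \<forall>x\<in>carrier M. i \<odot>\<^bsub>M\<^esub> x \<in> P"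
  show "ideal_smult M I \<subseteq> P"
  proof
    fix z assume "z \<in> ideal_smult M I"
    then show "z \<in> P"
      by induction (use * submoduleE(5)[OF P] in auto)
  qed
qed (auto intro: ideal_smult.smult)

text \<open>
  The products \<open>(ij)x\<close> generate \<open>KL\<close>. As they are symmetric in the two residuals, \<open>KL\<close> and
  \<open>LK\<close> lie in the same submodules.
\<close>

lemma submodule_prod_subset_iff_residuals:
  assumes P: "submodule P R M"
  shows "submodule_prod R M K L \<subseteq> P \<longleftrightarrow>
    (\<forall>i\<in>residual R M K. \<forall>j\<in>residual R M L. \<forall>x\<in>carrier M. (i \<otimes>\<^bsub>R\<^esub> j) \<odot>\<^bsub>M\<^esub> x \<in> P)"
proof
  assume *: "\<forall>i\<in>residual R M K. \<forall>j\<in>residual R M L. \<forall>x\<in>carrier M. (i \<otimes>\<^bsub>R\<^esub> j) \<odot>\<^bsub>M\<^esub> x \<in> P"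
  have "r \<in> carrier R \<and> (\<forall>x\<in>carrier M. r \<odot>\<^bsub>M\<^esub> x \<in> P)"
    if "r \<in> ideal_prod R (residual R M K) (residual R M L)" for r
    using that
    by induction (use * submoduleE(5)[OF P] in \<open>auto simp: mem_residual_iff smult_l_distr\<close>)
  then show "submodule_prod R M K L \<subseteq> P"
    unfolding submodule_prod_def ideal_smult_subset_iff[OF P] by blast
next
  assume "submodule_prod R M K L \<subseteq> P"
  then show "\<forall>i\<in>residual R M K. \<forall>j\<in>residual R M L. \<forall>x\<in>carrier M. (i \<otimes>\<^bsub>R\<^esub> j) \<odot>\<^bsub>M\<^esub> x \<in> P"
    unfolding submodule_prod_def ideal_smult_subset_iff[OF P] by (blast intro: ideal_prod.prod)
qed

lemma submodule_prod_subset_commute: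
  assumes P: "submodule P R M"
  shows "submodule_prod R M K L \<subseteq> P \<longleftrightarrow> submodule_prod R M L K \<subseteq> P"
  unfolding submodule_prod_subset_iff_residuals[OF P]
  by (metis R.m_comm mem_residual_iff)

text \<open>
  If \<open>N = IM\<close>, then \<open>I \<subseteq> (N : M)\<close>, so the residual is the largest ideal that presents \<open>N\<close>.
\<close>

lemma ideal_smult_residual:
  assumes "multiplication_module R M" and N: "submodule N R M"
  shows "ideal_smult M (residual R M N) = N"
proof
  show "ideal_smult M (residual R M N) \<subseteq> N"
    unfolding ideal_smult_subset_iff[OF N] by (auto simp: mem_residual_iff)
next
  obtain I where I: "ideal I R" "N = ideal_smult M I"
    using assms unfolding multiplication_module_def by blast
  have "I \<subseteq> residual R M N"
    using I by (auto simp: mem_residual_iff ideal.Icarr intro: ideal_smult.smult)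
  have "z \<in> ideal_smult M (residual R M N)" if "z \<in> ideal_smult M I" for z
    using that
    by induction (use \<open>I \<subseteq> residual R M N\<close> in \<open>auto intro: ideal_smult.intros\<close>)
  with I show "N \<subseteq> ideal_smult M (residual R M N)"
    by blast
qed

text \<open>
  For fixed \<open>a\<close>, the elements \<open>l\<close> with \<open>al \<in> P\<close> form a submodule, and \<open>L = (L : M)M\<close> is
  generated by the elements \<open>jx\<close> with \<open>j \<in> (L : M)\<close>; so the residual of \<open>L\<close> can be
  replaced by \<open>L\<close> itself.
\<close>

lemma submodule_prod_subset_iff:
  assumes mult: "multiplication_module R M"
    and L: "submodule L R M" and P: "submodule P R M"
  shows "submodule_prod R M K L \<subseteq> P \<longleftrightarrow> (\<forall>a\<in>residual R M K. \<forall>l\<in>L. a \<odot>\<^bsub>M\<^esub> l \<in> P)"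
proof
  assume *: "submodule_prod R M K L \<subseteq> P"
  show "\<forall>a\<in>residual R M K. \<forall>l\<in>L. a \<odot>\<^bsub>M\<^esub> l \<in> P"
  proof (intro ballI)
    fix a l assume a: "a \<in> residual R M K" and "l \<in> L"
    then have "l \<in> ideal_smult M (residual R M L)"
      using ideal_smult_residual[OF mult L] by simp
    then have "l \<in> carrier M \<and> a \<odot>\<^bsub>M\<^esub> l \<in> P"
    proof induction
      case (smult j x)
      then have "(a \<otimes>\<^bsub>R\<^esub> j) \<odot>\<^bsub>M\<^esub> x \<in> P"
        using * a unfolding submodule_prod_subset_iff_residuals[OF P] by blast
      with smult a show ?case
        by (simp add: mem_residual_iff smult_assoc1)
    next
      case (sum x y)
      with a submoduleE(5)[OF P] show ?case
        by (simp add: mem_residual_iff smult_r_distr)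
    qed
    then show "a \<odot>\<^bsub>M\<^esub> l \<in> P" ..
  qed
next
  assume "\<forall>a\<in>residual R M K. \<forall>l\<in>L. a \<odot>\<^bsub>M\<^esub> l \<in> P"
  then show "submodule_prod R M K L \<subseteq> P"
    unfolding submodule_prod_subset_iff_residuals[OF P]
    by (auto simp: mem_residual_iff smult_assoc1)
qed

lemma submodule_prod_eq_zero_iff:
  assumes mult: "multiplication_module R M"
    and K: "submodule K R M" and L: "submodule L R M"
  shows "submodule_prod R M K L = {\<zero>\<^bsub>M\<^esub>} \<longleftrightarrow>
    (\<forall>a\<in>residual R M K. \<forall>l\<in>L. a \<odot>\<^bsub>M\<^esub> l = \<zero>\<^bsub>M\<^esub>)"
proof -
  have "\<zero>\<^bsub>R\<^esub> \<in> residual R M K" "\<zero>\<^bsub>R\<^esub> \<in> residual R M L"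
    using submodule_zero_closed[OF K] submodule_zero_closed[OF L]
    by (auto simp: mem_residual_iff)
  then have "(\<zero>\<^bsub>R\<^esub> \<otimes>\<^bsub>R\<^esub> \<zero>\<^bsub>R\<^esub>) \<odot>\<^bsub>M\<^esub> \<zero>\<^bsub>M\<^esub> \<in> submodule_prod R M K L"
    unfolding submodule_prod_def by (intro ideal_smult.smult ideal_prod.prod) auto
  then have "submodule_prod R M K L = {\<zero>\<^bsub>M\<^esub>} \<longleftrightarrow> submodule_prod R M K L \<subseteq> {\<zero>\<^bsub>M\<^esub>}"
    by auto
  then show ?thesis
    by (simp only: submodule_prod_subset_iff[OF mult L zero_submodule] singleton_iff)
qed

text \<open>
  That is, \<open>(aM)(Rm)\<close> is the cyclic submodule \<open>Ram\<close>. With \<open>P = N\<close> and \<open>P = 0\<close> this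
  translates \<open>0 \<noteq> KL \<subseteq> N\<close> into \<open>0 \<noteq> am \<in> N\<close>.
\<close>

lemma submodule_prod_cyclic:
  assumes mult: "multiplication_module R M" and a: "a \<in> carrier R" and m: "m \<in> carrier M"
    and P: "submodule P R M"
  shows "submodule_prod R M (smult_set M {a} (carrier M)) (smult_set M (carrier R) {m}) \<subseteq> P
    \<longleftrightarrow> a \<odot>\<^bsub>M\<^esub> m \<in> P" (is "submodule_prod R M ?K ?L \<subseteq> P \<longleftrightarrow> _")
proof
  have "a \<in> residual R M ?K"
    using a by (auto simp: mem_residual_iff smult_set_def)
  moreover have "m \<in> ?L"
    using m unfolding smult_set_def by (force intro: exI[of _ "\<one>\<^bsub>R\<^esub>"])
  ultimately show "a \<odot>\<^bsub>M\<^esub> m \<in> P" if "submodule_prod R M ?K ?L \<subseteq> P"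
    using that unfolding submodule_prod_subset_iff[OF mult submodule_cyclic[OF m] P] by blast
next
  assume am: "a \<odot>\<^bsub>M\<^esub> m \<in> P"
  have "j \<odot>\<^bsub>M\<^esub> k \<in> P" if j: "j \<in> residual R M ?L" and k: "k \<in> ?K" for j k
  proof -
    obtain y where y: "y \<in> carrier M" "k = a \<odot>\<^bsub>M\<^esub> y"
      using k unfolding smult_set_def by blast
    obtain r where r: "r \<in> carrier R" "j \<odot>\<^bsub>M\<^esub> y = r \<odot>\<^bsub>M\<^esub> m"
      using j y unfolding mem_residual_iff smult_set_def by blast
    have "j \<odot>\<^bsub>M\<^esub> k = a \<odot>\<^bsub>M\<^esub> (j \<odot>\<^bsub>M\<^esub> y)"
      using j y a by (simp add: mem_residual_iff smult_left_commute[of j a])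
    also have "\<dots> = r \<odot>\<^bsub>M\<^esub> (a \<odot>\<^bsub>M\<^esub> m)"
      using r a m by (simp add: smult_left_commute[of a r])
    finally show ?thesis
      using submoduleE(4)[OF P] r am by simp
  qed
  \<comment> \<open>The factors are exchanged so that the relation \<open>jM \<subseteq> Rm\<close> can be used on \<open>k = ay\<close>: in the
    given order, \<open>iM \<subseteq> aM\<close> would only give \<open>i(rm) = r(ay)\<close> with \<open>y\<close> unrelated to \<open>m\<close>.\<close>
  then have "submodule_prod R M ?L ?K \<subseteq> P"
    unfolding submodule_prod_subset_iff[OF mult submodule_smult_carrier[OF a] P] by blast
  then show "submodule_prod R M ?K ?L \<subseteq> P"
    using submodule_prod_subset_commute[OF P] by blast
qed

section \<open>Weakly \<open>S\<close>-prime submodules\<close>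

text \<open>
  Two applications of \<open>subgroup_subset_Un\<close> settle the zero products: for each \<open>a \<in> I\<close> with
  \<open>saM \<not>\<subseteq> N\<close>, one inside \<open>L\<close>, and then one inside \<open>I\<close>. The second extends
  \<open>aL = 0\<close> to those \<open>a \<in> I\<close> for which \<open>saM \<subseteq> N\<close>.
\<close>

lemma weakly_prime_covering:
  assumes s: "s \<in> carrier R" and N: "submodule N R M"
    and prime: "\<And>a m. \<lbrakk>a \<in> carrier R; m \<in> carrier M; a \<odot>\<^bsub>M\<^esub> m \<noteq> \<zero>\<^bsub>M\<^esub>; a \<odot>\<^bsub>M\<^esub> m \<in> N\<rbrakk>
      \<Longrightarrow> s \<otimes>\<^bsub>R\<^esub> a \<in> residual R M N \<or> s \<odot>\<^bsub>M\<^esub> m \<in> N"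
    and I: "subgroup I (add_monoid R)" and L: "submodule L R M"
    and IL: "\<And>a l. \<lbrakk>a \<in> I; l \<in> L\<rbrakk> \<Longrightarrow> a \<odot>\<^bsub>M\<^esub> l \<in> N"
  shows "(\<forall>a\<in>I. s \<otimes>\<^bsub>R\<^esub> a \<in> residual R M N) \<or> (\<forall>l\<in>L. s \<odot>\<^bsub>M\<^esub> l \<in> N) \<or>
    (\<forall>a\<in>I. \<forall>l\<in>L. a \<odot>\<^bsub>M\<^esub> l = \<zero>\<^bsub>M\<^esub>)"
proof (cases "\<forall>l\<in>L. s \<odot>\<^bsub>M\<^esub> l \<in> N")
  case sL: False
  have I_carrier: "a \<in> carrier R" if "a \<in> I" for a
    using subgroup.mem_carrier[OF I that] by simp
  have L_carrier: "L \<subseteq> carrier M"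
    using submoduleE(1)[OF L] .
  let ?T = "{a \<in> carrier R. \<forall>x\<in>smult_set M {s} (carrier M). a \<odot>\<^bsub>M\<^esub> x \<in> N}"
  let ?Z = "{a \<in> carrier R. \<forall>x\<in>L. a \<odot>\<^bsub>M\<^esub> x \<in> {\<zero>\<^bsub>M\<^esub>}}"
  have T_iff: "a \<in> ?T \<longleftrightarrow> s \<otimes>\<^bsub>R\<^esub> a \<in> residual R M N" if "a \<in> carrier R" for a
    using that s by (auto simp: mem_residual_iff smult_set_def smult_assoc1 smult_left_commute[of s a])
  have "I \<subseteq> ?T \<union> ?Z"
  proof
    fix a assume a: "a \<in> I"
    note aR = I_carrier[OF a]
    show "a \<in> ?T \<union> ?Z"
    proof (cases "a \<in> ?T")
      case False
      then have "L \<subseteq> {m \<in> carrier M. s \<odot>\<^bsub>M\<^esub> m \<in> N} \<union> {m \<in> carrier M. a \<odot>\<^bsub>M\<^esub> m \<in> {\<zero>\<^bsub>M\<^esub>}}"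
        using prime[OF aR] IL[OF a] L_carrier T_iff[OF aR] by blast
      then have "L \<subseteq> {m \<in> carrier M. a \<odot>\<^bsub>M\<^esub> m \<in> {\<zero>\<^bsub>M\<^esub>}}"
        using M.add.subgroup_subset_Un[OF submodule.axioms(1)[OF L] subgroup_module_colon[OF N s]
            subgroup_module_colon[OF zero_submodule aR]] sL by blast
      with aR show ?thesis by blast
    qed blast
  qed
  moreover have "subgroup ?T (add_monoid R)"
    using s by (intro subgroup_ring_colon[OF N]) (auto simp: smult_set_def)
  moreover have "subgroup ?Z (add_monoid R)"
    by (rule subgroup_ring_colon[OF zero_submodule L_carrier])
  ultimately have "I \<subseteq> ?T \<or> I \<subseteq> ?Z"
    using R.add.subgroup_subset_Un[OF I] by blast
  then show ?thesis
    using T_iff I_carrier by blast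
qed blast

end

theorem theorem2:
  fixes R :: "('a, 'r) ring_scheme"
    and M :: "('a, 'b, 'm) module_scheme"
    and S :: "'a set"
    and N :: "'b set"
  assumes "cring R" and "\<one>\<^bsub>R\<^esub> \<noteq> \<zero>\<^bsub>R\<^esub>"
    and "module R M"
    and "faithful_module R M"
    and "multiplication_module R M"
    and "mult_closed_subset R S"
    and "submodule N R M"
  shows "weakly_S_prime R M S N \<longleftrightarrow>
    residual R M N \<inter> S = {} \<and>
    (\<exists>s\<in>S. \<forall>K L. submodule K R M \<and> submodule L R M \<and>
        submodule_prod R M K L \<noteq> {\<zero>\<^bsub>M\<^esub>} \<and> submodule_prod R M K L \<subseteq> N \<longrightarrow>
        smult_set M {s} K \<subseteq> N \<or> smult_set M {s} L \<subseteq> N)"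
proof -
  interpret module R M by fact
  note mult = \<open>multiplication_module R M\<close> and N = \<open>submodule N R M\<close>
  have S: "s \<in> carrier R" if "s \<in> S" for s
    using that \<open>mult_closed_subset R S\<close> unfolding mult_closed_subset_def by blast
  \<comment> \<open>The two sides use the same \<open>s\<close>, so the conditions are compared for a fixed witness.\<close>
  have "(\<forall>a\<in>carrier R. \<forall>m\<in>carrier M. a \<odot>\<^bsub>M\<^esub> m \<noteq> \<zero>\<^bsub>M\<^esub> \<and> a \<odot>\<^bsub>M\<^esub> m \<in> N \<longrightarrow>
      s \<otimes>\<^bsub>R\<^esub> a \<in> residual R M N \<or> s \<odot>\<^bsub>M\<^esub> m \<in> N) \<longleftrightarrow>
    (\<forall>K L. submodule K R M \<and> submodule L R M \<and>
      submodule_prod R M K L \<noteq> {\<zero>\<^bsub>M\<^esub>} \<and> submodule_prod R M K L \<subseteq> N \<longrightarrow>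
      smult_set M {s} K \<subseteq> N \<or> smult_set M {s} L \<subseteq> N)" (is "?elements \<longleftrightarrow> ?submodules")
    if "s \<in> S" for s
  proof
    note s = S[OF that]
    assume el: ?elements
    show ?submodules
    proof (intro allI impI)
      fix K L
      assume "submodule K R M \<and> submodule L R M \<and>
        submodule_prod R M K L \<noteq> {\<zero>\<^bsub>M\<^esub>} \<and> submodule_prod R M K L \<subseteq> N"
      then have K: "submodule K R M" and L: "submodule L R M"
        and nz: "submodule_prod R M K L \<noteq> {\<zero>\<^bsub>M\<^esub>}" and sub: "submodule_prod R M K L \<subseteq> N"
        by auto
      have "residual R M K = {r \<in> carrier R. \<forall>x\<in>carrier M. r \<odot>\<^bsub>M\<^esub> x \<in> K}"
        by (auto simp: mem_residual_iff)
      then have I: "subgroup (residual R M K) (add_monoid R)"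
        using subgroup_ring_colon[OF K] by simp
      have "(\<forall>a\<in>residual R M K. s \<otimes>\<^bsub>R\<^esub> a \<in> residual R M N) \<or> (\<forall>l\<in>L. s \<odot>\<^bsub>M\<^esub> l \<in> N) \<or>
          (\<forall>a\<in>residual R M K. \<forall>l\<in>L. a \<odot>\<^bsub>M\<^esub> l = \<zero>\<^bsub>M\<^esub>)"
      proof (rule weakly_prime_covering[OF s N _ I L])
        show "a \<odot>\<^bsub>M\<^esub> l \<in> N" if "a \<in> residual R M K" "l \<in> L" for a l
          using sub that unfolding submodule_prod_subset_iff[OF mult L N] by blast
      qed (use el in blast)
      then consider "\<forall>a\<in>residual R M K. s \<otimes>\<^bsub>R\<^esub> a \<in> residual R M N" | "\<forall>l\<in>L. s \<odot>\<^bsub>M\<^esub> l \<in> N"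
        using nz submodule_prod_eq_zero_iff[OF mult K L] by blast
      then show "smult_set M {s} K \<subseteq> N \<or> smult_set M {s} L \<subseteq> N"
      proof cases
        case 1
        \<comment> \<open>The submodule \<open>(N :\<^sub>M s)\<close> contains the generators \<open>ax\<close> of \<open>K = (K : M)M\<close>.\<close>
        have "k \<in> carrier M \<and> s \<odot>\<^bsub>M\<^esub> k \<in> N" if "k \<in> ideal_smult M (residual R M K)" for k
          using that
        proof induction
          case (smult a x)
          with 1 s show ?case
            by (auto simp: mem_residual_iff smult_assoc1)
        next
          case (sum x y)
          with s submoduleE(5)[OF N] show ?case
            by (simp add: smult_r_distr)
        qed
        then show ?thesis
          unfolding ideal_smult_residual[OF mult K] smult_set_def by blast
      next
        case 2
        then show ?thesis
          unfolding smult_set_def by blast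
      qed
    qed
  next
    note s = S[OF that]
    assume sub: ?submodules
    show ?elements
    proof (intro ballI impI)
      fix a m assume a: "a \<in> carrier R" and m: "m \<in> carrier M"
        and am: "a \<odot>\<^bsub>M\<^esub> m \<noteq> \<zero>\<^bsub>M\<^esub> \<and> a \<odot>\<^bsub>M\<^esub> m \<in> N"
      let ?K = "smult_set M {a} (carrier M)" and ?L = "smult_set M (carrier R) {m}"
      have "submodule_prod R M ?K ?L \<subseteq> N"
        using am submodule_prod_cyclic[OF mult a m N] by blast
      moreover have "submodule_prod R M ?K ?L \<noteq> {\<zero>\<^bsub>M\<^esub>}"
        using am submodule_prod_cyclic[OF mult a m zero_submodule] by blast
      ultimately have "smult_set M {s} ?K \<subseteq> N \<or> smult_set M {s} ?L \<subseteq> N"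
        using sub submodule_smult_carrier[OF a] submodule_cyclic[OF m] by blast
      then show "s \<otimes>\<^bsub>R\<^esub> a \<in> residual R M N \<or> s \<odot>\<^bsub>M\<^esub> m \<in> N"
      proof
        assume "smult_set M {s} ?K \<subseteq> N"
        then have "s \<otimes>\<^bsub>R\<^esub> a \<in> residual R M N"
          using s a unfolding smult_set_def by (auto simp: mem_residual_iff smult_assoc1)
        then show ?thesis ..
      next
        assume *: "smult_set M {s} ?L \<subseteq> N"
        have "\<one>\<^bsub>R\<^esub> \<odot>\<^bsub>M\<^esub> m \<in> ?L"
          unfolding smult_set_def by blast
        with * m have "s \<odot>\<^bsub>M\<^esub> m \<in> N"
          unfolding smult_set_def by auto
        then show ?thesis ..
      qed
    qed
  qed
  then show ?thesis
    unfolding weakly_S_prime_def using N by blast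
qed

end
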